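(* Let $s\in\mathbb{N}$ and let $t=4w+z$ with $w\in\mathbb{N}$ and $z\in\{0,1,2,3\}$. Then $C_3^tC_4^s$ can be gracefully labelled if $t=4w$ or $t=4w+1$, and can be near gracefully labelled if $t=4w+2$ or $t=4w+3$.
   Context: Here $\mathbb{N}$ includes $0$. $C_n^t$ denotes the union of $t$ cycles of length $n$ sharing exactly one common (central) vertex, and $C_3^tC_4^s$ denotes the graph obtained by identifying the central vertices of $C_3^t$ and $C_4^s$ (a windmill with $t$ triangle vanes and $s$ $4$-cycle vanes). For a graph $G$ with $m$ edges, a graceful labelling is an injective map $f:V(G)\to\{0,\ldots,m\}$ such that $g(uv)=|f(u)-f(v)|$ is a bijection $E(G)\to\{1,\ldots,m\}$. A near graceful labelling is an injective map $f:V(G)\to\{0,\ldots,m+1\}$ such that $g(uv)=|f(u)-f(v)|$ is a bijection onto $\{1,\ldots,m-1,m\}$ or onto $\{1,\ldots,m-1,m+1\}$. *)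

theory Defs
  imports Main "HOL-Library.FuncSet"
begin

record 'a graph =
  verts :: "'a set"
  edges :: "'a set set"

definition simple_graph :: "'a graph \<Rightarrow> bool" where
  "simple_graph G \<longleftrightarrow> finite (verts G) \<and> (\<forall>e\<in>edges G. e \<subseteq> verts G \<and> card e = 2)"

definition edge_label :: "('a \<Rightarrow> int) \<Rightarrow> 'a set \<Rightarrow> int" where
  "edge_label f e = (THE k. \<exists>u v. e = {u, v} \<and> k = \<bar>f u - f v\<bar>)"

lemma edge_label_doubleton: "edge_label f {u, v} = \<bar>f u - f v\<bar>"
  unfolding edge_label_def by (rule the_equality) (auto simp: doubleton_eq_iff)

definition graceful_labelling :: "'a graph \<Rightarrow> ('a \<Rightarrow> int) \<Rightarrow> bool" where
  "graceful_labelling G f \<longleftrightarrow>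
    (let m = int (card (edges G)) in
      f \<in> verts G \<rightarrow> {0..m} \<and> inj_on f (verts G) \<and>
      bij_betw (edge_label f) (edges G) {1..m})"

definition near_graceful_labelling :: "'a graph \<Rightarrow> ('a \<Rightarrow> int) \<Rightarrow> bool" where
  "near_graceful_labelling G f \<longleftrightarrow>
    (let m = int (card (edges G)) in
      f \<in> verts G \<rightarrow> {0..m + 1} \<and> inj_on f (verts G) \<and>
      (bij_betw (edge_label f) (edges G) {1..m} \<or>
       bij_betw (edge_label f) (edges G) ({1..m - 1} \<union> {m + 1})))"

text \<open>\<open>Outer n i j\<close> is the \<open>j\<close>-th non-central vertex (\<open>0 < j < n\<close>) of the \<open>i\<close>-th \<open>n\<close>-cycle.
  Recording the cycle length \<open>n\<close> makes the models of \<open>C\<^sub>n\<^sup>t\<close> for distinct \<open>n\<close> meet in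
  \<open>Centre\<close> only, so that identifying their central vertices amounts to taking the union.\<close>

datatype vertex = Centre | Outer nat nat nat

definition vane_vertex :: "nat \<Rightarrow> nat \<Rightarrow> nat \<Rightarrow> vertex" where
  "vane_vertex n i j = (if j = 0 then Centre else Outer n i j)"

definition windmill :: "nat \<Rightarrow> nat \<Rightarrow> vertex graph" where
  "windmill n t =
    \<lparr>verts = insert Centre {vane_vertex n i j |i j. i < t \<and> j < n},
     edges = {{vane_vertex n i j, vane_vertex n i (Suc j mod n)} |i j. i < t \<and> j < n}\<rparr>"

definition graph_union :: "'a graph \<Rightarrow> 'a graph \<Rightarrow> 'a graph" where
  "graph_union G H = \<lparr>verts = verts G \<union> verts H, edges = edges G \<union> edges H\<rparr>"

definition windmill_3_4 :: "nat \<Rightarrow> nat \<Rightarrow> vertex graph" where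
  "windmill_3_4 t s = graph_union (windmill 3 t) (windmill 4 s)"

lemma windmill_verts_Int:
  assumes "n \<noteq> n'"
  shows "verts (windmill n t) \<inter> verts (windmill n' s) = {Centre}"
  using assms by (auto simp: windmill_def vane_vertex_def)

lemma simple_graph_windmill:
  assumes "3 \<le> n"
  shows "simple_graph (windmill n t)"
proof -
  have "finite (verts (windmill n t))"
    unfolding windmill_def by (simp add: finite_image_set2)
  moreover have "e \<subseteq> verts (windmill n t) \<and> card e = 2"
    if "e \<in> edges (windmill n t)" for e
  proof -
    from that obtain i j where ij: "i < t" "j < n"
      and e: "e = {vane_vertex n i j, vane_vertex n i (Suc j mod n)}"
      by (auto simp: windmill_def)
    have "vane_vertex n i k \<in> verts (windmill n t)" if "k < n" for k
      using that ij(1) by (auto simp: windmill_def)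
    then have "e \<subseteq> verts (windmill n t)"
      using assms ij(2) by (simp add: e)
    moreover have "vane_vertex n i j \<noteq> vane_vertex n i (Suc j mod n)"
      using assms ij by (auto simp: vane_vertex_def mod_Suc)
    ultimately show ?thesis by (simp add: e)
  qed
  ultimately show ?thesis by (simp add: simple_graph_def)
qed

lemma simple_graph_windmill_3_4: "simple_graph (windmill_3_4 t s)"
  using simple_graph_windmill[of 3 t] simple_graph_windmill[of 4 s]
  by (auto simp: simple_graph_def windmill_3_4_def graph_union_def)

lemma card_edges_windmill:
  assumes "3 \<le> n"
  shows "card (edges (windmill n t)) = n * t"
proof -
  let ?g = "\<lambda>(i, j). {vane_vertex n i j, vane_vertex n i (Suc j mod n)}"
  have "inj_on ?g ({..<t} \<times> {..<n})"
    using assms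
    by (auto simp: inj_on_def vane_vertex_def doubleton_eq_iff mod_Suc split: if_splits)
  moreover have "edges (windmill n t) = ?g ` ({..<t} \<times> {..<n})"
    by (auto simp: windmill_def)
  ultimately show ?thesis by (simp add: card_image)
qed

lemma card_edges_windmill_3_4: "card (edges (windmill_3_4 t s)) = 3 * t + 4 * s"
proof -
  have fin: "finite (edges (windmill n k))" for n k
    unfolding windmill_def by (simp add: finite_image_set2)
  have "edges (windmill 3 t) \<inter> edges (windmill 4 s) = {}"
  proof (rule ccontr)
    assume "\<not> ?thesis"
    then obtain e where e: "e \<in> edges (windmill 3 t)" "e \<in> edges (windmill 4 s)" by blast
    have "e \<subseteq> verts (windmill 3 t)" "card e = 2"
      using simple_graph_windmill[of 3 t] e(1) by (simp_all add: simple_graph_def)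
    moreover have "e \<subseteq> verts (windmill 4 s)"
      using simple_graph_windmill[of 4 s] e(2) by (simp add: simple_graph_def)
    moreover have "verts (windmill 3 t) \<inter> verts (windmill 4 s) = {Centre}"
      by (simp add: windmill_verts_Int)
    ultimately have "e \<subseteq> {Centre}" "card e = 2" by blast+
    then show False using card_mono[of "{Centre}" e] by auto
  qed
  then show ?thesis
    by (simp add: windmill_3_4_def graph_union_def card_Un_disjoint fin card_edges_windmill)
qed

end

theory Submission imports Defs begin

text \<open>The centre gets label \<open>0\<close>. A triangle labelled \<open>0, a, b\<close> uses the edge labels
  \<open>a, b, |b - a|\<close> and a \<open>4\<close>-cycle labelled \<open>0, a, c, b\<close> uses \<open>a, b, |a - c|, |b - c|\<close>.
  The triangles take the edge labels \<open>1..t\<close> as differences of the pairs of a (hooked) Skolem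
  sequence of order \<open>t\<close>, which is shifted by \<open>t + 4s\<close>. The \<open>4\<close>-cycles take
  \<open>t + 1..t + 4s\<close>: two disjoint intervals of length \<open>2r\<close>, each nested around its centre, provide
  two pairs for each of the differences \<open>c = 1, 3, \<dots>, 2r - 1\<close>. For \<open>s > t + 1\<close> a label \<open>c\<close> of this
  kind would coincide with a label next to the centre. Some \<open>4\<close>-cycles then use odd \<open>c\<close> with
  \<open>a + a' = b + b' = c\<close> instead: of \<open>a, a'\<close> either one may be put next to the centre, and choosing
  the even one avoids all the odd labels \<open>c\<close>.\<close>

section \<open>Reduction to arithmetic\<close>

fun triangle_edges :: "int \<times> int \<Rightarrow> int set" where
  "triangle_edges (a, b) = {a, b, \<bar>b - a\<bar>}"

fun square_edges :: "int \<times> int \<times> int \<Rightarrow> int set" where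
  "square_edges (a, c, b) = {a, b, \<bar>a - c\<bar>, \<bar>b - c\<bar>}"

definition opposite :: "int \<times> int \<times> int \<Rightarrow> int" where
  "opposite x = fst (snd x)"

text \<open>The \<open>i\<close>-th list entry labels the \<open>i\<close>-th vane. Positions follow
  the cycle, so 1 and the last position are the neighbours of the centre, and in a 4-cycle position
  2 is opposite to it.\<close>

fun vane_label :: "(int \<times> int) list \<Rightarrow> (int \<times> int \<times> int) list \<Rightarrow> vertex \<Rightarrow> int" where
  "vane_label T Q Centre = 0"
| "vane_label T Q (Outer n i j) =
    (if n = 3 then (if j = 1 then fst (T ! i) else snd (T ! i))
     else if j = 1 then fst (Q ! i) else if j = 2 then opposite (Q ! i) else snd (snd (Q ! i)))"

section \<open>Vertices and edges of the windmill\<close>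

lemma verts_windmill_3_4:
  "verts (windmill_3_4 t s) = insert Centre
     ({Outer 3 i j |i j. i < t \<and> j \<in> {1, 2}} \<union> {Outer 4 i j |i j. i < s \<and> j \<in> {1, 2, 3}})"
proof -
  have verts: "verts (windmill n k) = insert Centre {Outer n i j |i j. i < k \<and> 0 < j \<and> j < n}" for n k
  proof -
    have "Outer n i j \<in> verts (windmill n k)" if "i < k" "0 < j" "j < n" for i j
    proof -
      have "vane_vertex n i j \<in> verts (windmill n k)" using that by (auto simp: windmill_def)
      then show ?thesis using that by (simp add: vane_vertex_def)
    qed
    moreover have "Centre \<in> verts (windmill n k)" by (simp add: windmill_def)
    moreover have "verts (windmill n k) \<subseteq> insert Centre {Outer n i j |i j. i < k \<and> 0 < j \<and> j < n}"
      by (auto simp: windmill_def vane_vertex_def)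
    ultimately show ?thesis by blast
  qed
  have "0 < j \<and> j < 3 \<longleftrightarrow> j \<in> {1, 2}" "0 < j \<and> j < 4 \<longleftrightarrow> j \<in> {1, 2, 3}" for j :: nat
    by auto
  then show ?thesis unfolding windmill_3_4_def graph_union_def verts by simp
qed

lemma edges_windmill_3_I:
  assumes "i < t"
  shows "{Centre, Outer 3 i 1} \<in> edges (windmill_3_4 t s)"
    and "{Centre, Outer 3 i 2} \<in> edges (windmill_3_4 t s)"
    and "{Outer 3 i 1, Outer 3 i 2} \<in> edges (windmill_3_4 t s)"
proof -
  have *: "{vane_vertex 3 i j, vane_vertex 3 i k} \<in> edges (windmill_3_4 t s)"
    if "j < 3" "k = Suc j mod 3" for j k
    using assms that by (auto simp: windmill_3_4_def graph_union_def windmill_def)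
  show "{Centre, Outer 3 i 1} \<in> edges (windmill_3_4 t s)"
    and "{Centre, Outer 3 i 2} \<in> edges (windmill_3_4 t s)"
    and "{Outer 3 i 1, Outer 3 i 2} \<in> edges (windmill_3_4 t s)"
    using *[of 0 1] *[of 2 0] *[of 1 2] by (simp_all add: vane_vertex_def insert_commute)
qed

lemma edges_windmill_4_I:
  assumes "i < s"
  shows "{Centre, Outer 4 i 1} \<in> edges (windmill_3_4 t s)"
    and "{Centre, Outer 4 i 3} \<in> edges (windmill_3_4 t s)"
    and "{Outer 4 i 1, Outer 4 i 2} \<in> edges (windmill_3_4 t s)"
    and "{Outer 4 i 3, Outer 4 i 2} \<in> edges (windmill_3_4 t s)"
proof -
  have *: "{vane_vertex 4 i j, vane_vertex 4 i k} \<in> edges (windmill_3_4 t s)"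
    if "j < 4" "k = Suc j mod 4" for j k
    using assms that by (auto simp: windmill_3_4_def graph_union_def windmill_def)
  show "{Centre, Outer 4 i 1} \<in> edges (windmill_3_4 t s)"
    and "{Centre, Outer 4 i 3} \<in> edges (windmill_3_4 t s)"
    and "{Outer 4 i 1, Outer 4 i 2} \<in> edges (windmill_3_4 t s)"
    and "{Outer 4 i 3, Outer 4 i 2} \<in> edges (windmill_3_4 t s)"
    using *[of 0 1] *[of 3 0] *[of 1 2] *[of 2 3] by (simp_all add: vane_vertex_def insert_commute)
qed

text \<open>The number of edges equals the number of required edge labels, so covering the required
  labels already makes the edge labelling bijective; this in turn makes the labels of the
  neighbours of the centre distinct.\<close>

lemma windmill_3_4_labelling:
  fixes E :: "int set"
  assumes card_E: "card E = 3 * t + 4 * s"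
    and cover: "E \<subseteq> (\<Union>x\<in>set T. triangle_edges x) \<union> (\<Union>x\<in>set Q. square_edges x)"
    and len: "length T = t" "length Q = s"
    and T_range: "\<And>a b. (a, b) \<in> set T \<Longrightarrow> a \<in> {1..M} \<and> b \<in> {1..M}"
    and Q_range: "\<And>a c b. (a, c, b) \<in> set Q \<Longrightarrow> a \<in> {1..M} \<and> c \<in> {1..M} \<and> b \<in> {1..M}"
    and dist: "distinct (map opposite Q)"
    and T_opp: "\<And>a b. (a, b) \<in> set T \<Longrightarrow> a \<notin> opposite ` set Q \<and> b \<notin> opposite ` set Q"
    and Q_opp: "\<And>a c b. (a, c, b) \<in> set Q \<Longrightarrow> a \<notin> opposite ` set Q \<and> b \<notin> opposite ` set Q"
    and "0 \<le> M"
  shows "\<exists>f. f \<in> verts (windmill_3_4 t s) \<rightarrow> {0..M} \<and> inj_on f (verts (windmill_3_4 t s)) \<and>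
    bij_betw (edge_label f) (edges (windmill_3_4 t s)) E"
proof -
  let ?G = "windmill_3_4 t s" and ?f = "vane_label T Q"
  \<comment> \<open>\<open>N\<close> consists of the neighbours of the centre, \<open>C\<close> of
    the vertices opposite to it in the 4-cycles. Their injectivity has different sources: edge
    labels for \<open>N\<close>, the distinctness assumption for \<open>C\<close>.\<close>
  define N where "N = {Outer 3 i j |i j. i < t \<and> j \<in> {1, 2}} \<union> {Outer 4 i j |i j. i < s \<and> j \<in> {1, 3}}"
  define C where "C = {Outer 4 i 2 |i. i < s}"
  have T_nth: "(fst (T ! i), snd (T ! i)) \<in> set T" if "i < t" for i
    using that len by simp
  have Q_nth: "(fst (Q ! i), opposite (Q ! i), snd (snd (Q ! i))) \<in> set Q" if "i < s" for i
    using that len by (simp add: opposite_def)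
  have fin: "finite (edges ?G)"
    unfolding windmill_3_4_def graph_union_def windmill_def by (simp add: finite_image_set2)
  have "triangle_edges x \<subseteq> edge_label ?f ` edges ?G" if x: "x \<in> set T" for x
  proof -
    obtain i where i: "i < t" "x = T ! i" using x len by (metis in_set_conv_nth)
    have "fst x \<ge> 1" "snd x \<ge> 1" using T_range[OF T_nth[OF i(1)]] i by auto
    then have "triangle_edges x = edge_label ?f `
        {{Centre, Outer 3 i 1}, {Centre, Outer 3 i 2}, {Outer 3 i 1, Outer 3 i 2}}"
      using i by (cases "T ! i") (simp add: edge_label_doubleton abs_minus_commute)
    then show ?thesis using edges_windmill_3_I[OF i(1)] by blast
  qed
  moreover have "square_edges x \<subseteq> edge_label ?f ` edges ?G" if x: "x \<in> set Q" for x
  proof -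
    obtain i where i: "i < s" "x = Q ! i" using x len by (metis in_set_conv_nth)
    obtain a c b where abc: "x = (a, c, b)" using prod_cases3 by blast
    have "a \<ge> 1" "b \<ge> 1" using Q_range[of a c b] x abc by auto
    then have "square_edges x = edge_label ?f `
        {{Centre, Outer 4 i 1}, {Centre, Outer 4 i 3}, {Outer 4 i 1, Outer 4 i 2},
         {Outer 4 i 3, Outer 4 i 2}}"
      using i abc by (simp add: edge_label_doubleton opposite_def flip: i(2))
    then show ?thesis using edges_windmill_4_I[OF i(1), where t = t] by blast
  qed
  ultimately have E_sub: "E \<subseteq> edge_label ?f ` edges ?G" using cover by blast
  moreover have "card (edge_label ?f ` edges ?G) \<le> card E"
    using card_image_le[OF fin] card_E by (simp add: card_edges_windmill_3_4)
  ultimately have E_eq: "edge_label ?f ` edges ?G = E"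
    using card_seteq fin by (metis finite_imageI)
  then have inj_E: "inj_on (edge_label ?f) (edges ?G)"
    using fin card_E by (intro eq_card_imp_inj_on) (simp_all add: card_edges_windmill_3_4)
  have N_range: "?f u \<in> {1..M} \<and> ?f u \<notin> opposite ` set Q" if "u \<in> N" for u
  proof -
    consider i where "i < t" "u = Outer 3 i 1 \<or> u = Outer 3 i 2"
      | i where "i < s" "u = Outer 4 i 1 \<or> u = Outer 4 i 3"
      using \<open>u \<in> N\<close> unfolding N_def by blast
    then show ?thesis
    proof cases
      case 1 then show ?thesis using T_range[OF T_nth] T_opp[OF T_nth] by fastforce
    next
      case 2 then show ?thesis using Q_range[OF Q_nth] Q_opp[OF Q_nth] by fastforce
    qed
  qed
  have N_edge: "{Centre, u} \<in> edges ?G" if "u \<in> N" for u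
    using that edges_windmill_3_I edges_windmill_4_I by (auto simp: N_def)
  have inj_N: "inj_on ?f N"
  proof (rule inj_onI)
    fix u v assume uv: "u \<in> N" "v \<in> N" "?f u = ?f v"
    \<comment> \<open>The centre has label 0, so the label of a neighbour determines the label of
      its edge to the centre.\<close>
    then have "edge_label ?f {Centre, u} = edge_label ?f {Centre, v}"
      by (simp add: edge_label_doubleton)
    then have "{Centre, u} = {Centre, v}"
      using inj_onD[OF inj_E] N_edge uv(1,2) by blast
    then show "u = v" by (auto simp: doubleton_eq_iff)
  qed
  have C_range: "?f u \<in> {1..M} \<and> ?f u \<in> opposite ` set Q" if "u \<in> C" for u
    using that Q_range[OF Q_nth] len by (auto simp: C_def)
  have inj_C: "inj_on ?f C"
  proof (rule inj_onI)
    fix u v assume "u \<in> C" "v \<in> C" "?f u = ?f v"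
    then obtain i j where ij: "i < s" "j < s" "u = Outer 4 i 2" "v = Outer 4 j 2"
      "map opposite Q ! i = map opposite Q ! j"
      using len by (auto simp: C_def)
    then show "u = v" using dist len by (simp only: nth_eq_iff_index_eq length_map)
  qed
  have V: "verts ?G = insert Centre (N \<union> C)"
    unfolding verts_windmill_3_4 N_def C_def by auto
  have "?f ` N \<subseteq> - opposite ` set Q" "?f ` C \<subseteq> opposite ` set Q"
    using N_range C_range by (simp_all add: image_subset_iff)
  then have "?f ` N \<inter> ?f ` C = {}" by blast
  then have "inj_on ?f (N \<union> C)" using inj_N inj_C unfolding inj_on_Un by blast
  moreover have "?f Centre \<notin> ?f ` (N \<union> C)"
  proof (rule notI, elim imageE)
    fix u assume u: "?f Centre = ?f u" "u \<in> N \<union> C"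
    then have "?f u \<in> {1..M}" using N_range C_range by blast
    with u(1) show False by simp
  qed
  ultimately have "inj_on ?f (verts ?G)" unfolding V inj_on_insert by blast
  moreover have "?f \<in> verts ?G \<rightarrow> {0..M}"
  proof
    fix u assume "u \<in> verts ?G"
    then have "u = Centre \<or> ?f u \<in> {1..M}" unfolding V using N_range C_range by blast
    then show "?f u \<in> {0..M}" using \<open>0 \<le> M\<close> by auto
  qed
  ultimately show ?thesis using inj_E E_eq unfolding bij_betw_def by blast
qed

section \<open>Edge labels of the 4-cycles\<close>

text \<open>The edge labels up to \<open>t\<close> are left to the triangles. Labels next to the
  centre are edge labels as well, hence exceed \<open>t\<close>; opposite labels are vertex labels
  only and may be small. Distinctness of the former comes from counting edges, so only collisions
  involving opposite labels are excluded here.\<close>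

definition square_system :: "int \<Rightarrow> (int \<times> int \<times> int) list \<Rightarrow> bool" where
  "square_system t Q \<longleftrightarrow>
    (let M = t + 4 * int (length Q) in
      {t + 1..M} \<subseteq> (\<Union>x\<in>set Q. square_edges x) \<and>
      (\<forall>(a, c, b)\<in>set Q. a \<in> {t + 1..M} \<and> b \<in> {t + 1..M} \<and> c \<in> {1..M}) \<and>
      distinct (map opposite Q) \<and>
      (\<forall>(a, c, b)\<in>set Q. a \<notin> opposite ` set Q \<and> b \<notin> opposite ` set Q))"

text \<open>Cut \<open>m + 1..m + 4 * r\<close> into four blocks of length \<open>r\<close>. Triple
  \<open>i\<close> puts elements of the second and fourth block next to the centre; subtracting
  \<open>2 * i - 1\<close> reflects them into the first and third block.\<close>

definition nested_squares :: "int \<Rightarrow> int \<Rightarrow> (int \<times> int \<times> int) list" where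
  "nested_squares m r = map (\<lambda>i. (m + r + i, 2 * i - 1, m + 3 * r + i)) [1..r]"

lemma nested_squares_cover:
  assumes "0 \<le> m"
  shows "{m + 1..m + 4 * r} \<subseteq> (\<Union>x\<in>set (nested_squares m r). square_edges x)"
proof
  fix k assume k: "k \<in> {m + 1..m + 4 * r}"
  consider "k \<le> m + r" | "m + r < k" "k \<le> m + 2 * r" | "m + 2 * r < k" "k \<le> m + 3 * r"
    | "m + 3 * r < k" by linarith
  then obtain i where "1 \<le> i" "i \<le> r"
    "k \<in> square_edges (m + r + i, 2 * i - 1, m + 3 * r + i)"
  proof cases
    case 1 with k assms that[of "m + r + 1 - k"] show ?thesis by auto
  next
    case 2 with k assms that[of "k - m - r"] show ?thesis by auto
  next
    case 3 with k assms that[of "m + 3 * r + 1 - k"] show ?thesis by auto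
  next
    case 4 with k assms that[of "k - m - 3 * r"] show ?thesis by auto
  qed
  then show "k \<in> (\<Union>x\<in>set (nested_squares m r). square_edges x)"
    by (force simp: nested_squares_def simp del: square_edges.simps)
qed

text \<open>All opposite labels are odd, so the even labels next to the centre in \<open>P\<close>
  avoid them. The condition \<open>2 * r < c\<close> separates the opposite labels of
  \<open>P\<close> from the nested ones \<open>1, 3, ..., 2 * r - 1\<close>. The bounds
  \<open>c \<le> t + 4 * q + r\<close> and \<open>r \<le> t + 4 * q + 1\<close> keep every opposite
  label below the nested labels next to the centre.\<close>

lemma square_system_append_nested:
  fixes t q r :: int
  assumes "0 \<le> t" "0 \<le> r" and q: "q = int (length P)" and r: "r \<le> t + 4 * q + 1"
    and cover: "{t + 1..t + 4 * q} \<subseteq> (\<Union>x\<in>set P. square_edges x)"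
    and P: "\<And>a c b. (a, c, b) \<in> set P \<Longrightarrow> even a \<and> even b \<and> odd c \<and>
      a \<in> {t + 1..t + 4 * q} \<and> b \<in> {t + 1..t + 4 * q} \<and> 2 * r < c \<and> c \<le> t + 4 * q + r"
    and dist: "distinct (map opposite P)"
  shows "square_system t (P @ nested_squares (t + 4 * q) r)"
    and "\<forall>c \<in> opposite ` set (P @ nested_squares (t + 4 * q) r). odd c"
proof -
  let ?W = "nested_squares (t + 4 * q) r"
  have len: "int (length (P @ ?W)) = q + r"
    using q \<open>0 \<le> r\<close> by (simp add: nested_squares_def)
  have W: "\<exists>i. 1 \<le> i \<and> i \<le> r \<and> a = t + 4 * q + r + i \<and> c = 2 * i - 1 \<and> b = t + 4 * q + 3 * r + i"
    if "(a, c, b) \<in> set ?W" for a c b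
    using that by (auto simp: nested_squares_def)
  have oppP: "odd c \<and> 2 * r < c \<and> c \<le> t + 4 * q + r" if "c \<in> opposite ` set P" for c
    using that P by (auto simp: opposite_def)
  have oppW: "odd c \<and> 1 \<le> c \<and> c < 2 * r" if "c \<in> opposite ` set ?W" for c
    using that by (auto simp: opposite_def nested_squares_def)
  show odd: "\<forall>c \<in> opposite ` set (P @ ?W). odd c"
    using oppP oppW by (auto simp: image_Un)
  have "{t + 1..t + 4 * (q + r)} \<subseteq> {t + 1..t + 4 * q} \<union> {t + 4 * q + 1..t + 4 * q + 4 * r}"
    by auto
  also have "\<dots> \<subseteq> (\<Union>x\<in>set (P @ ?W). square_edges x)"
    using cover nested_squares_cover[of "t + 4 * q" r] assms(1) q by auto
  finally have 1: "{t + 1..t + 4 * (q + r)} \<subseteq> (\<Union>x\<in>set (P @ ?W). square_edges x)" .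
  have 2: "a \<in> {t + 1..t + 4 * (q + r)} \<and> b \<in> {t + 1..t + 4 * (q + r)} \<and> c \<in> {1..t + 4 * (q + r)}"
    if "(a, c, b) \<in> set (P @ ?W)" for a c b
    using that P[of a c b] W[of a c b] r q assms(1,2) by auto
  have 3: "distinct (map opposite (P @ ?W))"
  proof -
    have "distinct (map opposite ?W)"
      by (auto simp: nested_squares_def opposite_def distinct_map inj_on_def)
    moreover have "opposite ` set P \<inter> opposite ` set ?W = {}"
      using oppP oppW by fastforce
    ultimately show ?thesis using dist by simp
  qed
  have 4: "a \<notin> opposite ` set (P @ ?W) \<and> b \<notin> opposite ` set (P @ ?W)"
    if abc: "(a, c, b) \<in> set (P @ ?W)" for a c b
  proof (cases "(a, c, b) \<in> set P")
    case True
    then show ?thesis using P odd by blast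
  next
    case False
    then obtain i where "1 \<le> i" "i \<le> r" "a = t + 4 * q + r + i" "b = t + 4 * q + 3 * r + i"
      using W[of a c b] abc by auto
    then have "a > t + 4 * q + r \<and> a \<ge> 2 * r \<and> b > t + 4 * q + r \<and> b \<ge> 2 * r"
      using r assms(1,2) q by auto
    then show ?thesis using oppP oppW by (force simp: image_Un)
  qed
  show "square_system t (P @ ?W)"
    unfolding square_system_def Let_def len using 1 2 3 4 by fast
qed

section \<open>4-cycles made of pairs with equal odd sum\<close>

definition even_of :: "int \<Rightarrow> int \<Rightarrow> int" where
  "even_of p p' = (if even p then p else p')"

text \<open>If \<open>p1 + p2 = c\<close>, the edge from label \<open>c\<close> to one of
  \<open>p1\<close>, \<open>p2\<close> has the other as its edge label. Choosing which of them sits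
  next to the centre therefore leaves the set of edge labels unchanged.\<close>

lemma square_edges_even_of:
  assumes "p1 + p2 = c" "p3 + p4 = c" "0 \<le> p1" "0 \<le> p2" "0 \<le> p3" "0 \<le> p4"
  shows "square_edges (even_of p1 p2, c, even_of p3 p4) = {p1, p2, p3, p4}"
  using assms by (auto simp: even_of_def)

text \<open>Of the four blocks of length \<open>q\<close> in \<open>t + 1..t + 4 * q\<close>, the
  first is paired with the fourth and the second with the third. Both pairs of triple
  \<open>i\<close> have the same sum, which descends in steps of 2 from \<open>2 * t + 5 * q\<close>
  to \<open>2 * t + 3 * q + 2\<close>; it is odd when \<open>q\<close> is.\<close>

definition sum_squares :: "int \<Rightarrow> int \<Rightarrow> (int \<times> int \<times> int) list" where
  "sum_squares t q = map (\<lambda>i. (even_of (t + q + 1 - i) (t + 4 * q + 1 - i), 2 * t + 5 * q + 2 - 2 * i,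
     even_of (t + 2 * q + 1 - i) (t + 3 * q + 1 - i))) [1..q]"

lemma sum_squares_cover:
  assumes "0 \<le> t"
  shows "{t + 1..t + 4 * q} \<subseteq> (\<Union>x\<in>set (sum_squares t q). square_edges x)"
proof
  fix k assume k: "k \<in> {t + 1..t + 4 * q}"
  consider "k \<le> t + q" | "t + q < k" "k \<le> t + 2 * q" | "t + 2 * q < k" "k \<le> t + 3 * q"
    | "t + 3 * q < k" by linarith
  then obtain i where i: "1 \<le> i" "i \<le> q"
    "k \<in> {t + q + 1 - i, t + 4 * q + 1 - i, t + 2 * q + 1 - i, t + 3 * q + 1 - i}"
  proof cases
    case 1 with k that[of "t + q + 1 - k"] show ?thesis by auto
  next
    case 2 with k that[of "t + 2 * q + 1 - k"] show ?thesis by auto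
  next
    case 3 with k that[of "t + 3 * q + 1 - k"] show ?thesis by auto
  next
    case 4 with k that[of "t + 4 * q + 1 - k"] show ?thesis by auto
  qed
  have "k \<in> square_edges (even_of (t + q + 1 - i) (t + 4 * q + 1 - i), 2 * t + 5 * q + 2 - 2 * i,
     even_of (t + 2 * q + 1 - i) (t + 3 * q + 1 - i))"
    using i assms by (subst square_edges_even_of) auto
  then show "k \<in> (\<Union>x\<in>set (sum_squares t q). square_edges x)"
    using i by (force simp: sum_squares_def simp del: square_edges.simps)
qed

text \<open>The two bounds on \<open>r\<close> place the sums in the window required for appending
  nested 4-cycles: \<open>t + q \<le> r\<close> handles the largest sum,
  \<open>2 * r \<le> 2 * t + 3 * q + 2\<close> the smallest.\<close>

lemma square_system_odd:
  fixes t q r :: int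
  assumes "0 \<le> t" "0 \<le> q" "odd q" "t + q \<le> r" "2 * r \<le> 2 * t + 3 * q + 2"
  shows "\<exists>Q. int (length Q) = q + r \<and> square_system t Q \<and> (\<forall>c \<in> opposite ` set Q. odd c)"
proof -
  let ?P = "sum_squares t q"
  have len: "q = int (length ?P)" using \<open>0 \<le> q\<close> by (simp add: sum_squares_def)
  have "even a \<and> even b \<and> odd c \<and> a \<in> {t + 1..t + 4 * q} \<and> b \<in> {t + 1..t + 4 * q} \<and>
      2 * r < c \<and> c \<le> t + 4 * q + r" if abc: "(a, c, b) \<in> set ?P" for a c b
  proof -
    obtain i where i: "1 \<le> i" "i \<le> q" "a = even_of (t + q + 1 - i) (t + 4 * q + 1 - i)"
      "c = 2 * t + 5 * q + 2 - 2 * i" "b = even_of (t + 2 * q + 1 - i) (t + 3 * q + 1 - i)"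
      using abc unfolding sum_squares_def by auto
    have "odd c" using i \<open>odd q\<close> by simp
    \<comment> \<open>Parity turns the bound \<open>2 * r \<le> c\<close> into the strict
      one.\<close>
    moreover from this have "c \<noteq> 2 * r" by auto
    moreover have "even a" "even b" using i \<open>odd q\<close> by (auto simp: even_of_def)
    moreover have "a \<in> {t + 1..t + 4 * q}" "b \<in> {t + 1..t + 4 * q}"
      using i by (auto simp: even_of_def)
    moreover have "2 * r \<le> c" "c \<le> t + 4 * q + r" using i assms by auto
    ultimately show ?thesis by simp
  qed
  moreover have "distinct (map opposite ?P)"
    by (auto simp: sum_squares_def opposite_def distinct_map inj_on_def)
  moreover have "int (length (?P @ nested_squares (t + 4 * q) r)) = q + r"
    using assms len by (simp add: nested_squares_def)
  moreover have "r \<le> t + 4 * q + 1" "0 \<le> r" using assms by auto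
  ultimately show ?thesis
    using square_system_append_nested[OF \<open>0 \<le> t\<close> _ len _ sum_squares_cover[OF \<open>0 \<le> t\<close>], of r] by blast
qed

section \<open>Exceptional numbers of 4-cycles\<close>

lemma int_atLeastAtMost_4: "{t + 1..t + 4} = {t + 1, t + 2, t + 3, t + 4 :: int}"
  by auto

lemma int_atLeastAtMost_8:
  "{t + 1..t + 8} = {t + 1, t + 2, t + 3, t + 4, t + 5, t + 6, t + 7, t + 8 :: int}"
  by auto

lemma int_atLeastAtMost_16:
  "{t + 1..t + 16} = {t + 1, t + 2, t + 3, t + 4, t + 5, t + 6, t + 7, t + 8,
     t + 9, t + 10, t + 11, t + 12, t + 13, t + 14, t + 15, t + 16 :: int}"
  by (rule set_eqI) (simp, presburger)

text \<open>The families above reach all \<open>s\<close> except those with \<open>s - t\<close> equal to 4, 5 or 9; the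
  systems for these were found by computer search.\<close>

lemma square_system_5:
  assumes "0 \<le> (t::int)"
  shows "\<exists>Q. int (length Q) = t + 5 \<and> square_system t Q"
proof -
  \<comment> \<open>Here \<open>q = 2\<close> and \<open>r = t + 3\<close>, so the admissible odd
    sums run from \<open>2 * t + 7\<close> to \<open>2 * t + 11\<close>; both ends are used.\<close>
  let ?P = "[(even_of (t + 1) (t + 6), 2 * t + 7, even_of (t + 2) (t + 5)),
    (even_of (t + 3) (t + 8), 2 * t + 11, even_of (t + 4) (t + 7))]"
  have "{t + 1..t + 4 * 2} \<subseteq> (\<Union>x\<in>set ?P. square_edges x)"
    using assms by (simp add: square_edges_even_of int_atLeastAtMost_8 del: square_edges.simps)
  moreover have "even a \<and> even b \<and> odd c \<and> a \<in> {t + 1..t + 4 * 2} \<and> b \<in> {t + 1..t + 4 * 2} \<and>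
      2 * (t + 3) < c \<and> c \<le> t + 4 * 2 + (t + 3)" if "(a, c, b) \<in> set ?P" for a c b
    using that by (auto simp: even_of_def)
  ultimately have "square_system t (?P @ nested_squares (t + 4 * 2) (t + 3))"
    using assms by (intro square_system_append_nested) (auto simp: opposite_def)
  moreover have "int (length (?P @ nested_squares (t + 4 * 2) (t + 3))) = t + 5"
    using assms by (simp add: nested_squares_def)
  ultimately show ?thesis by blast
qed

lemma square_system_9:
  assumes "0 \<le> (t::int)"
  shows "\<exists>Q. int (length Q) = t + 9 \<and> square_system t Q"
proof -
  let ?P = "[(even_of (t + 8) (t + 5), 2 * t + 13, even_of (t + 7) (t + 6)),
    (even_of (t + 14) (t + 1), 2 * t + 15, even_of (t + 13) (t + 2)),
    (even_of (t + 16) (t + 3), 2 * t + 19, even_of (t + 15) (t + 4)),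
    (even_of (t + 12) (t + 9), 2 * t + 21, even_of (t + 11) (t + 10))]"
  have "{t + 1..t + 4 * 4} \<subseteq> (\<Union>x\<in>set ?P. square_edges x)"
    using assms by (simp add: square_edges_even_of int_atLeastAtMost_16 del: square_edges.simps)
  moreover have "even a \<and> even b \<and> odd c \<and> a \<in> {t + 1..t + 4 * 4} \<and> b \<in> {t + 1..t + 4 * 4} \<and>
      2 * (t + 5) < c \<and> c \<le> t + 4 * 4 + (t + 5)" if "(a, c, b) \<in> set ?P" for a c b
    using that by (auto simp: even_of_def)
  ultimately have "square_system t (?P @ nested_squares (t + 4 * 4) (t + 5))"
    using assms by (intro square_system_append_nested) (auto simp: opposite_def)
  moreover have "int (length (?P @ nested_squares (t + 4 * 4) (t + 5))) = t + 9"
    using assms by (simp add: nested_squares_def)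
  ultimately show ?thesis by blast
qed

text \<open>With \<open>M\<close> the largest edge label so far, the new 4-cycle has edge labels
  \<open>M + 3\<close>, \<open>M + 4\<close> and, after subtracting 2, \<open>M + 1\<close>,
  \<open>M + 2\<close>. Its opposite label 2 is not next to the centre, since those labels exceed
  \<open>t \<ge> 2\<close>.\<close>

lemma square_system_append_2:
  assumes Q: "square_system t Q" and "2 \<le> t" and "2 \<notin> opposite ` set Q"
  shows "square_system t
    (Q @ [(t + 4 * int (length Q) + 3, 2, t + 4 * int (length Q) + 4)])"
proof -
  define M where "M = t + 4 * int (length Q)"
  let ?Q = "Q @ [(M + 3, 2, M + 4)]"
  have M: "2 \<le> M" using \<open>2 \<le> t\<close> by (simp add: M_def)
  have len: "t + 4 * int (length ?Q) = M + 4" by (simp add: M_def)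
  have cover: "{t + 1..M} \<subseteq> (\<Union>x\<in>set Q. square_edges x)"
    and range: "\<And>a c b. (a, c, b) \<in> set Q \<Longrightarrow> a \<in> {t + 1..M} \<and> b \<in> {t + 1..M} \<and> c \<in> {1..M}"
    and dist: "distinct (map opposite Q)"
    and opp: "\<And>a c b. (a, c, b) \<in> set Q \<Longrightarrow> a \<notin> opposite ` set Q \<and> b \<notin> opposite ` set Q"
    using Q unfolding square_system_def Let_def M_def by fast+
  have le: "c \<le> M" if "c \<in> opposite ` set Q" for c
    using that range by (auto simp: opposite_def)
  have set_Q: "set ?Q = insert (M + 3, 2, M + 4) (set Q)" by simp
  have opp_Q: "opposite ` set ?Q = insert 2 (opposite ` set Q)" by (simp add: opposite_def)
  have "{t + 1..M + 4} \<subseteq> {t + 1..M} \<union> {M + 1..M + 4}" by auto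
  also have "\<dots> \<subseteq> (\<Union>x\<in>set ?Q. square_edges x)"
    using cover M by (auto simp: int_atLeastAtMost_4)
  finally have 1: "{t + 1..M + 4} \<subseteq> (\<Union>x\<in>set ?Q. square_edges x)" .
  have 2: "a \<in> {t + 1..M + 4} \<and> b \<in> {t + 1..M + 4} \<and> c \<in> {1..M + 4}"
    if "(a, c, b) \<in> set ?Q" for a c b
    using that range[of a c b] M M_def by auto
  have 3: "distinct (map opposite ?Q)"
    using dist assms(3) by (simp add: opposite_def)
  have 4: "a \<notin> opposite ` set ?Q \<and> b \<notin> opposite ` set ?Q" if "(a, c, b) \<in> set ?Q" for a c b
  proof (cases "(a, c, b) \<in> set Q")
    case True
    then show ?thesis using opp[OF True] range[OF True] \<open>2 \<le> t\<close> unfolding opp_Q by auto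
  next
    case False
    then have "a = M + 3" "b = M + 4" using that by auto
    then show ?thesis using le[of a] le[of b] M unfolding opp_Q by auto
  qed
  show ?thesis
    using 1 2 3 4 unfolding M_def[symmetric] square_system_def Let_def len by fast
qed

lemma square_system_exists:
  assumes "0 \<le> (t::int)" "0 \<le> s"
  shows "\<exists>Q. int (length Q) = s \<and> square_system t Q"
proof -
  consider "s \<le> t + 1" | "s = t + 4" "t = 0" | "s = t + 4" "t = 1" | "s = t + 4" "2 \<le> t"
    | "s = t + 5" | "s = t + 9" | "t + 2 \<le> s" "s - t \<notin> {4, 5, 9}"
    using assms by force
  then show ?thesis
  proof cases
    case 1
    \<comment> \<open>With no 4-cycles of the other kind, the bound on \<open>r\<close> becomes
      \<open>s \<le> t + 1\<close>.\<close>
    have "square_system t ([] @ nested_squares (t + 4 * 0) s)"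
      using 1 assms by (intro square_system_append_nested) auto
    then show ?thesis using assms by (intro exI conjI) (auto simp: nested_squares_def)
  next
    case 2
    \<comment> \<open>For \<open>t = 0\<close> and \<open>t = 1\<close> the system with
      \<open>q = 1\<close> and \<open>r = t + 2\<close> has label 2 next to the centre, so no
      4-cycle with opposite label 2 can be appended; explicit systems are checked by evaluation
      instead.\<close>
    then show ?thesis
      by (intro exI[of _ "[(16, 1, 2), (14, 3, 6), (13, 4, 8), (12, 5, 10)]"])
        (simp add: square_system_def opposite_def upto_rec1 flip: set_upto)
  next
    case 3
    then show ?thesis
      by (intro exI[of _ "[(21, 1, 3), (19, 2, 6), (18, 4, 9), (16, 5, 15), (13, 20, 12)]"])
        (simp add: square_system_def opposite_def upto_rec1 flip: set_upto)
  next
    case 4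
    \<comment> \<open>A system for \<open>s - 1\<close> 4-cycles with only odd opposite labels
      leaves 2 free as the opposite label of one more.\<close>
    obtain Q where Q: "int (length Q) = 1 + (t + 2)" "square_system t Q" "\<forall>c \<in> opposite ` set Q. odd c"
      using square_system_odd[of t 1 "t + 2"] assms by auto
    then have "2 \<notin> opposite ` set Q" by fastforce
    with square_system_append_2[OF Q(2) 4(2)] show ?thesis
      using Q(1) 4(1) by (intro exI conjI) auto
  next
    case 5
    then show ?thesis using square_system_5 assms by simp
  next
    case 6
    then show ?thesis using square_system_9 assms by simp
  next
    case 7
    \<comment> \<open>The largest odd number not exceeding \<open>(s - t) / 2\<close>. For
      \<open>s - t \<ge> 2\<close> the inequality \<open>2 * (s - t) \<le> 5 * q + 2\<close> then
      fails exactly at 4, 5 and 9.\<close>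
    define q where "q = (if odd ((s - t) div 2) then (s - t) div 2 else (s - t) div 2 - 1)"
    have q: "odd q" "0 \<le> q" "2 * q \<le> s - t" "2 * (s - t) \<le> 5 * q + 2"
      using 7 unfolding q_def by (simp; presburger)+
    have "t + q \<le> s - q" "2 * (s - q) \<le> 2 * t + 3 * q + 2" using q by auto
    from square_system_odd[OF assms(1) q(2,1) this] show ?thesis by auto
  qed
qed

section \<open>Skolem sequences\<close>

text \<open>A Skolem sequence of order \<open>t\<close> (\<open>W = {1..2t}\<close>) or a hooked one
  (\<open>W = {1..2t-1} \<union> {2t+1}\<close>), given by the pairs of positions carrying equal entries.\<close>

definition skolem :: "int set \<Rightarrow> (int \<times> int) list \<Rightarrow> bool" where
  "skolem W S \<longleftrightarrow> W = fst ` set S \<union> snd ` set S \<and>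
     {1..int (length S)} \<subseteq> (\<lambda>x. snd x - fst x) ` set S"

text \<open>Nested arcs: left ends run up from \<open>a + 1\<close>, right ends run down from
  \<open>b - 1\<close>. The differences are consecutive numbers of one parity, so a nest supplies a
  whole range of even or of odd entries.\<close>

definition nest :: "int \<Rightarrow> int \<Rightarrow> int \<Rightarrow> (int \<times> int) list" where
  "nest a b n = map (\<lambda>r. (a + r, b - r)) [1..n]"

lemma length_nest [simp]: "length (nest a b n) = nat n"
  by (simp add: nest_def)

lemma nest_fst [simp]: "fst ` set (nest a b n) = {a + 1..a + n}"
  by (simp add: nest_def image_image)

lemma nest_snd [simp]: "snd ` set (nest a b n) = {b - n..b - 1}"
  by (simp add: nest_def image_image image_diff_atLeastAtMost)

lemma nest_diff [simp]:
  "(\<lambda>x. snd x - fst x) ` set (nest a b n) = {d \<in> {b - a - 2 * n..b - a - 2}. even (d - (b - a))}"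
proof (intro set_eqI iffI)
  fix d assume d: "d \<in> {d \<in> {b - a - 2 * n..b - a - 2}. even (d - (b - a))}"
  then obtain k where "d - (b - a) = 2 * k" by blast
  \<comment> \<open>The difference of the \<open>r\<close>-th pair is \<open>b - a - 2 * r\<close>,
    so \<open>r = - k\<close>.\<close>
  then have "d = (b - - k) - (a + - k)" "- k \<in> {1..n}" using d by auto
  then show "d \<in> (\<lambda>x. snd x - fst x) ` set (nest a b n)"
    by (simp add: nest_def image_image image_iff) (intro bexI[of _ "- k"], auto)
qed (auto simp: nest_def)

section \<open>Existence for the four residues of the order modulo 4\<close>

lemma skolem_4w:
  fixes w :: int
  assumes "0 \<le> w"
  shows "\<exists>S. int (length S) = 4 * w \<and> skolem {1..8 * w} S"
proof -
  consider "w = 0" | "w = 1" | "2 \<le> w" using assms by linarith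
  then show ?thesis
  proof cases
    case 1
    have "skolem {} []"
      by (simp add: skolem_def upto_rec1 insert_commute flip: set_upto)
    with 1 show ?thesis by (intro exI conjI) auto
  next
    case 2
    have "skolem {1..8} [(1, 5), (3, 6), (2, 4), (7, 8)]"
      by (simp add: skolem_def upto_rec1 insert_commute flip: set_upto)
    with 2 show ?thesis by (intro exI conjI) auto
  next
    case 3
    \<comment> \<open>The nests give the differences \<open>2, 4, ..., 4w\<close>, the odd ones from
      \<open>2w + 3\<close> to \<open>4w - 3\<close> and those from 3 to \<open>2w - 3\<close>. The
      single pairs add \<open>2w + 1\<close>, 1, \<open>2w - 1\<close>, \<open>4w - 1\<close> and
      fill the positions left over.\<close>
    let ?S = "nest (4 * w - 1) (8 * w + 1) (2 * w) @ nest 0 (4 * w - 1) (w - 2) @ nest (w + 1) (3 * w) (w - 2) @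
      [(w - 1, 3 * w), (w, w + 1), (2 * w, 4 * w - 1), (2 * w + 1, 6 * w)]"
    have len: "int (length ?S) = 4 * w" using 3 by simp
    have "{1..8 * w} \<subseteq> fst ` set ?S \<union> snd ` set ?S"
      using 3 by (intro subsetI) (simp add: image_Un, smt (verit))
    moreover have "fst ` set ?S \<union> snd ` set ?S \<subseteq> {1..8 * w}"
      using 3 by (auto simp: image_Un)
    moreover have "{1..int (length ?S)} \<subseteq> (\<lambda>x. snd x - fst x) ` set ?S"
    proof
      fix d assume d: "d \<in> {1..int (length ?S)}"
      show "d \<in> (\<lambda>x. snd x - fst x) ` set ?S"
      proof (cases "even d")
        case True
        then obtain k where "d = 2 * k" by blast
        with d 3 show ?thesis unfolding len by (simp add: image_Un; linarith)
      next
        case False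
        then obtain k where "d = 2 * k + 1" using oddE by blast
        with d 3 show ?thesis unfolding len by (simp add: image_Un; presburger)
      qed
    qed
    ultimately show ?thesis using len unfolding skolem_def by (intro exI[of _ ?S] conjI equalityI)
  qed
qed

lemma skolem_4w_1:
  fixes w :: int
  assumes "0 \<le> w"
  shows "\<exists>S. int (length S) = 4 * w + 1 \<and> skolem {1..8 * w + 2} S"
proof -
  consider "w = 0" | "w = 1" | "2 \<le> w" using assms by linarith
  then show ?thesis
  proof cases
    case 1
    have "skolem {1..2} [(1, 2)]"
      by (simp add: skolem_def upto_rec1 insert_commute flip: set_upto)
    with 1 show ?thesis by (intro exI conjI) auto
  next
    case 2
    have "skolem {1..10} [(1, 6), (3, 7), (5, 8), (2, 4), (9, 10)]"
      by (simp add: skolem_def upto_rec1 insert_commute flip: set_upto)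
    with 2 show ?thesis by (intro exI conjI) auto
  next
    case 3
    \<comment> \<open>The nests give the differences \<open>2, 4, ..., 4w\<close>, the odd ones from
      \<open>2w + 1\<close> to \<open>4w - 1\<close> and those from 3 to \<open>2w - 3\<close>; the
      single pairs add 1, \<open>4w + 1\<close>, \<open>2w - 1\<close>.\<close>
    let ?S = "nest (4 * w + 1) (8 * w + 3) (2 * w) @ nest 0 (4 * w + 1) w @ nest (w + 2) (3 * w + 1) (w - 2) @
      [(w + 1, w + 2), (2 * w + 1, 6 * w + 2), (2 * w + 2, 4 * w + 1)]"
    have len: "int (length ?S) = 4 * w + 1" using 3 by simp
    have "{1..8 * w + 2} \<subseteq> fst ` set ?S \<union> snd ` set ?S"
      using 3 by (intro subsetI) (simp add: image_Un, smt (verit))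
    moreover have "fst ` set ?S \<union> snd ` set ?S \<subseteq> {1..8 * w + 2}"
      using 3 by (auto simp: image_Un)
    moreover have "{1..int (length ?S)} \<subseteq> (\<lambda>x. snd x - fst x) ` set ?S"
    proof
      fix d assume d: "d \<in> {1..int (length ?S)}"
      show "d \<in> (\<lambda>x. snd x - fst x) ` set ?S"
      proof (cases "even d")
        case True
        then obtain k where "d = 2 * k" by blast
        with d 3 show ?thesis unfolding len by (simp add: image_Un; linarith)
      next
        case False
        then obtain k where "d = 2 * k + 1" using oddE by blast
        with d 3 show ?thesis unfolding len by (simp add: image_Un; presburger)
      qed
    qed
    ultimately show ?thesis using len unfolding skolem_def by (intro exI[of _ ?S] conjI equalityI)
  qed
qed

lemma hooked_skolem_4w_2:
  fixes w :: int
  assumes "0 \<le> w"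
  shows "\<exists>S. int (length S) = 4 * w + 2 \<and> skolem ({1..8 * w + 3} \<union> {8 * w + 5}) S"
proof -
  consider "w = 0" | "1 \<le> w" using assms by linarith
  then show ?thesis
  proof cases
    case 1
    have "skolem ({1..3} \<union> {5}) [(1, 2), (3, 5)]"
      by (simp add: skolem_def upto_rec1 insert_commute flip: set_upto)
    with 1 show ?thesis by (intro exI conjI) auto
  next
    case 2
    \<comment> \<open>The nests give the differences \<open>2, 4, ..., 4w\<close>, the odd ones from
      \<open>2w + 3\<close> to \<open>4w - 1\<close> and those from 3 to \<open>2w - 1\<close>. The
      single pairs add \<open>4w + 1\<close>, \<open>2w + 1\<close>, \<open>4w + 2\<close>, 1; the
      largest difference uses the hook at \<open>8w + 5\<close>.\<close>
    let ?S = "nest 0 (4 * w + 2) (2 * w) @ nest (4 * w + 3) (8 * w + 4) (w - 1) @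
      nest (5 * w + 2) (7 * w + 3) (w - 1) @
      [(2 * w + 1, 6 * w + 2), (4 * w + 2, 6 * w + 3), (4 * w + 3, 8 * w + 5), (7 * w + 3, 7 * w + 4)]"
    have len: "int (length ?S) = 4 * w + 2" using 2 by simp
    have "({1..8 * w + 3} \<union> {8 * w + 5}) \<subseteq> fst ` set ?S \<union> snd ` set ?S"
      using 2 by (intro subsetI) (simp add: image_Un, smt (verit))
    moreover have "fst ` set ?S \<union> snd ` set ?S \<subseteq> ({1..8 * w + 3} \<union> {8 * w + 5})"
      using 2 by (auto simp: image_Un)
    moreover have "{1..int (length ?S)} \<subseteq> (\<lambda>x. snd x - fst x) ` set ?S"
    proof
      fix d assume d: "d \<in> {1..int (length ?S)}"
      show "d \<in> (\<lambda>x. snd x - fst x) ` set ?S"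
      proof (cases "even d")
        case True
        then obtain k where "d = 2 * k" by blast
        with d 2 show ?thesis unfolding len by (simp add: image_Un; linarith)
      next
        case False
        then obtain k where "d = 2 * k + 1" using oddE by blast
        with d 2 show ?thesis unfolding len by (simp add: image_Un; presburger)
      qed
    qed
    ultimately show ?thesis using len unfolding skolem_def by (intro exI[of _ ?S] conjI equalityI)
  qed
qed

lemma hooked_skolem_4w_3:
  fixes w :: int
  assumes "0 \<le> w"
  shows "\<exists>S. int (length S) = 4 * w + 3 \<and> skolem ({1..8 * w + 5} \<union> {8 * w + 7}) S"
proof -
  consider "w = 0" | "1 \<le> w" using assms by linarith
  then show ?thesis
  proof cases
    case 1
    have "skolem ({1..5} \<union> {7}) [(1, 4), (2, 3), (5, 7)]"
      by (simp add: skolem_def upto_rec1 insert_commute flip: set_upto)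
    with 1 show ?thesis by (intro exI conjI) auto
  next
    case 2
    \<comment> \<open>The nests give the differences \<open>2, 4, ..., 4w\<close>, the odd ones from
      \<open>2w + 5\<close> to \<open>4w + 1\<close> and those from 3 to \<open>2w - 1\<close>. The
      single pairs add \<open>2w + 3\<close>, 1, \<open>2w + 1\<close>, \<open>4w + 2\<close>,
      \<open>4w + 3\<close>; the last ends at the hook.\<close>
    let ?S = "nest (4 * w + 4) (8 * w + 6) (2 * w) @ nest 0 (4 * w + 3) (w - 1) @ nest (w + 2) (3 * w + 3) (w - 1) @
      [(w, 3 * w + 3), (w + 1, w + 2), (2 * w + 2, 4 * w + 3), (2 * w + 3, 6 * w + 5),
       (4 * w + 4, 8 * w + 7)]"
    have len: "int (length ?S) = 4 * w + 3" using 2 by simp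
    have "({1..8 * w + 5} \<union> {8 * w + 7}) \<subseteq> fst ` set ?S \<union> snd ` set ?S"
      using 2 by (intro subsetI) (simp add: image_Un, smt (verit))
    moreover have "fst ` set ?S \<union> snd ` set ?S \<subseteq> ({1..8 * w + 5} \<union> {8 * w + 7})"
      using 2 by (auto simp: image_Un)
    moreover have "{1..int (length ?S)} \<subseteq> (\<lambda>x. snd x - fst x) ` set ?S"
    proof
      fix d assume d: "d \<in> {1..int (length ?S)}"
      show "d \<in> (\<lambda>x. snd x - fst x) ` set ?S"
      proof (cases "even d")
        case True
        then obtain k where "d = 2 * k" by blast
        with d 2 show ?thesis unfolding len by (simp add: image_Un; linarith)
      next
        case False
        then obtain k where "d = 2 * k + 1" using oddE by blast
        with d 2 show ?thesis unfolding len by (simp add: image_Un; presburger)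
      qed
    qed
    ultimately show ?thesis using len unfolding skolem_def by (intro exI[of _ ?S] conjI equalityI)
  qed
qed

section \<open>Combination\<close>

text \<open>Shifting the positions by \<open>t + 4 * s\<close> preserves their differences and moves
  them above all labels used by the 4-cycles. So the triangles supply the edge labels up to
  \<open>t\<close> and the shifted \<open>W\<close>, the 4-cycles supply those in between, and no
  triangle label meets an opposite label.\<close>

lemma windmill_3_4_labelling_of_skolem:
  assumes S: "skolem W S" "length S = t" and W: "W \<subseteq> {1..N}" "card W = 2 * t" and "0 \<le> N"
  shows "\<exists>f. f \<in> verts (windmill_3_4 t s) \<rightarrow> {0..int (t + 4 * s) + N} \<and>
    inj_on f (verts (windmill_3_4 t s)) \<and>
    bij_betw (edge_label f) (edges (windmill_3_4 t s))
      ({1..int (t + 4 * s)} \<union> (+) (int (t + 4 * s)) ` W)"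
proof -
  define m where "m = int (t + 4 * s)"
  obtain Q where Q_len: "length Q = s" and Q: "square_system (int t) Q"
    using square_system_exists[of "int t" "int s"] by auto
  have m: "m = int t + 4 * int (length Q)" by (simp add: m_def Q_len)
  have cover: "{int t + 1..m} \<subseteq> (\<Union>x\<in>set Q. square_edges x)"
    and range: "\<And>a c b. (a, c, b) \<in> set Q \<Longrightarrow>
      a \<in> {int t + 1..m} \<and> b \<in> {int t + 1..m} \<and> c \<in> {1..m}"
    and dist: "distinct (map opposite Q)"
    and opp: "\<And>a c b. (a, c, b) \<in> set Q \<Longrightarrow> a \<notin> opposite ` set Q \<and> b \<notin> opposite ` set Q"
    using Q unfolding square_system_def Let_def m by fast+
  have opp_le: "c \<le> m" if "c \<in> opposite ` set Q" for c
    using that range by (auto simp: opposite_def)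
  let ?T = "map (\<lambda>x. (m + fst x, m + snd x)) S"
  have W_eq: "W = fst ` set S \<union> snd ` set S"
    and diffs: "{1..int t} \<subseteq> (\<lambda>x. snd x - fst x) ` set S"
    using S unfolding skolem_def by auto
  have T_range: "a \<in> {m + 1..m + N} \<and> b \<in> {m + 1..m + N}" if ab: "(a, b) \<in> set ?T" for a b
  proof -
    obtain x where x: "x \<in> set S" "a = m + fst x" "b = m + snd x" using ab by auto
    then have "fst x \<in> W" "snd x \<in> W" using W_eq by auto
    then show ?thesis using x W(1) by auto
  qed
  have E_cover: "{1..m} \<union> (+) m ` W \<subseteq> (\<Union>x\<in>set ?T. triangle_edges x) \<union> (\<Union>x\<in>set Q. square_edges x)"
  proof
    fix k assume "k \<in> {1..m} \<union> (+) m ` W"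
    then consider "k \<in> {1..int t}" | "k \<in> {int t + 1..m}" | "k \<in> (+) m ` W" by fastforce
    then show "k \<in> (\<Union>x\<in>set ?T. triangle_edges x) \<union> (\<Union>x\<in>set Q. square_edges x)"
    proof cases
      case 1
      then obtain x where "x \<in> set S" "k = snd x - fst x" using diffs by blast
      moreover from this have "k \<in> triangle_edges (m + fst x, m + snd x)" using 1 by auto
      ultimately show ?thesis by (auto simp del: triangle_edges.simps)
    next
      case 2
      then show ?thesis using cover by blast
    next
      case 3
      then obtain x where "x \<in> set S" "k = m + fst x \<or> k = m + snd x" using W_eq by blast
      moreover from this have "k \<in> triangle_edges (m + fst x, m + snd x)" by auto
      ultimately show ?thesis by (auto simp del: triangle_edges.simps)
    qed
  qed
  have E_card: "card ({1..m} \<union> (+) m ` W) = 3 * t + 4 * s"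
  proof -
    have "{1..m} \<inter> (+) m ` W = {}" using W(1) by fastforce
    moreover have "finite W" using W(1) finite_subset by blast
    ultimately show ?thesis using W(2) by (simp add: card_Un_disjoint card_image m_def)
  qed
  have T_range': "a \<in> {1..m + N} \<and> b \<in> {1..m + N}" if "(a, b) \<in> set ?T" for a b
    using T_range[OF that] m by auto
  have Q_range: "a \<in> {1..m + N} \<and> c \<in> {1..m + N} \<and> b \<in> {1..m + N}"
    if "(a, c, b) \<in> set Q" for a c b
    using range[OF that] \<open>0 \<le> N\<close> by auto
  have T_opp: "a \<notin> opposite ` set Q \<and> b \<notin> opposite ` set Q" if "(a, b) \<in> set ?T" for a b
    using T_range[OF that] opp_le[of a] opp_le[of b] by auto
  have nonneg: "0 \<le> m + N" using m \<open>0 \<le> N\<close> by simp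
  have T_len: "length ?T = t" using S(2) by simp
  show ?thesis
    unfolding m_def[symmetric]
    by (rule windmill_3_4_labelling[OF E_card E_cover T_len Q_len T_range' Q_range dist T_opp opp nonneg])
qed

lemma graceful_of_skolem:
  assumes "skolem {1..n} S" "int (length S) = int t" "n = 2 * int t"
  shows "\<exists>f. graceful_labelling (windmill_3_4 t s) f"
proof -
  have S: "skolem {1..2 * int t} S" "length S = t" using assms by auto
  have E: "{1..int (t + 4 * s)} \<union> (+) (int (t + 4 * s)) ` {1..2 * int t} = {1..int (3 * t + 4 * s)}"
    by auto
  show ?thesis
    using windmill_3_4_labelling_of_skolem[OF S, of "2 * int t" s]
    unfolding graceful_labelling_def Let_def card_edges_windmill_3_4 E by (simp add: algebra_simps)
qed

text \<open>The gap of the hooked sequence before its last position becomes the gap in the edge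
  labels: with \<open>m = 3 * t + 4 * s\<close> edges, \<open>m\<close> is skipped and
  \<open>m + 1\<close> occurs, the second alternative of a near graceful labelling.\<close>

lemma near_graceful_of_hooked_skolem:
  assumes "skolem ({1..n} \<union> {n'}) S" "int (length S) = int t" "n = 2 * int t - 1"
    "n' = 2 * int t + 1" "0 < t"
  shows "\<exists>f. near_graceful_labelling (windmill_3_4 t s) f"
proof -
  have S: "skolem ({1..2 * int t - 1} \<union> {2 * int t + 1}) S" "length S = t" using assms by auto
  let ?W = "{1..2 * int t - 1} \<union> {2 * int t + 1}"
  have "(+) (int (t + 4 * s)) ` ?W =
      {int (t + 4 * s) + 1..int (3 * t + 4 * s) - 1} \<union> {int (3 * t + 4 * s) + 1}"
    by (simp add: image_Un algebra_simps)
  moreover have "{1..int (t + 4 * s)} \<union> {int (t + 4 * s) + 1..int (3 * t + 4 * s) - 1} =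
      {1..int (3 * t + 4 * s) - 1}"
    using \<open>0 < t\<close> by (intro set_eqI) (simp, linarith)
  ultimately have E: "{1..int (t + 4 * s)} \<union> (+) (int (t + 4 * s)) ` ?W =
      {1..int (3 * t + 4 * s) - 1} \<union> {int (3 * t + 4 * s) + 1}"
    by (simp only: Un_assoc[symmetric])
  have "card ?W = card {1..2 * int t - 1} + card {2 * int t + 1}"
    by (rule card_Un_disjoint) auto
  then have "card ?W = 2 * t" using \<open>0 < t\<close> by simp
  moreover have "?W \<subseteq> {1..2 * int t + 1}" by auto
  moreover have M: "int (t + 4 * s) + (2 * int t + 1) = int (3 * t + 4 * s) + 1" by simp
  ultimately obtain f where "f \<in> verts (windmill_3_4 t s) \<rightarrow> {0..int (3 * t + 4 * s) + 1}"
    "inj_on f (verts (windmill_3_4 t s))"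
    "bij_betw (edge_label f) (edges (windmill_3_4 t s))
      ({1..int (3 * t + 4 * s) - 1} \<union> {int (3 * t + 4 * s) + 1})"
    using windmill_3_4_labelling_of_skolem[OF S, of "2 * int t + 1" s] unfolding E M by auto
  then show ?thesis
    unfolding near_graceful_labelling_def Let_def card_edges_windmill_3_4 by blast
qed

theorem theorem4p4:
  fixes s t w z :: nat
  assumes "t = 4 * w + z" and "z \<in> {0, 1, 2, 3}"
  shows "(t = 4 * w \<or> t = 4 * w + 1 \<longrightarrow> (\<exists>f. graceful_labelling (windmill_3_4 t s) f)) \<and>
         (t = 4 * w + 2 \<or> t = 4 * w + 3 \<longrightarrow> (\<exists>f. near_graceful_labelling (windmill_3_4 t s) f))"
proof (intro conjI impI)
  assume "t = 4 * w \<or> t = 4 * w + 1"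
  then show "\<exists>f. graceful_labelling (windmill_3_4 t s) f"
  proof
    assume t: "t = 4 * w"
    obtain S where S: "int (length S) = 4 * int w" "skolem {1..8 * int w} S"
      using skolem_4w[of "int w"] by auto
    show ?thesis by (rule graceful_of_skolem[OF S(2)]) (use S(1) t in simp_all)
  next
    assume t: "t = 4 * w + 1"
    obtain S where S: "int (length S) = 4 * int w + 1" "skolem {1..8 * int w + 2} S"
      using skolem_4w_1[of "int w"] by auto
    show ?thesis by (rule graceful_of_skolem[OF S(2)]) (use S(1) t in simp_all)
  qed
next
  assume "t = 4 * w + 2 \<or> t = 4 * w + 3"
  then show "\<exists>f. near_graceful_labelling (windmill_3_4 t s) f"
  proof
    assume t: "t = 4 * w + 2"
    obtain S where S: "int (length S) = 4 * int w + 2" "skolem ({1..8 * int w + 3} \<union> {8 * int w + 5}) S"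
      using hooked_skolem_4w_2[OF of_nat_0_le_iff, of w] by blast
    show ?thesis by (rule near_graceful_of_hooked_skolem[OF S(2)]) (use S(1) t in simp_all)
  next
    assume t: "t = 4 * w + 3"
    obtain S where S: "int (length S) = 4 * int w + 3" "skolem ({1..8 * int w + 5} \<union> {8 * int w + 7}) S"
      using hooked_skolem_4w_3[OF of_nat_0_le_iff, of w] by blast
    show ?thesis by (rule near_graceful_of_hooked_skolem[OF S(2)]) (use S(1) t in simp_all)
  qed
qed

end
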